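(* Let $L$ be a nonempty set, let $\mathcal C$ be the set of all consequence operators on $L$, ordered by $C_1\le C_2$ iff $C_1(X)\subseteq C_2(X)$ for all $X\subseteq L$, and let $I$ be the identity map on $\mathcal P(L)$. For $x\in L$ let $E_x=C'(\{x\},L\setminus\{x\})$, i.e. $E_x(A)=A\cup\{x\}$ if $L\setminus\{x\}\subseteq A$ and $E_x(A)=A$ otherwise, and let $\mathcal E_0=\{E_x : x\in L\}$. Then: (a) each $E_x$ is an atom of $\langle\mathcal C,\le\rangle$, i.e. $I< E_x$ and there is no $C\in\mathcal C$ with $I<C<E_x$; and (b) the set $\mathcal C_A$ of all axiomatic consequence operators on $L$ densely covers $\mathcal E_0$, i.e. for every $C\in\mathcal C$ with $C(\emptyset)\neq\emptyset$ there exists $x\in L$ with $E_x\le C$.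
   Context: A consequence operator on a nonempty set $L$ is a map $C\colon\mathcal P(L)\to\mathcal P(L)$ such that for all $X,Y\subseteq L$: $X\subseteq C(X)=C(C(X))\subseteq L$, and $X\subseteq Y$ implies $C(X)\subseteq C(Y)$. $C$ is axiomatic if $C(\emptyset)\ne\emptyset$. $C_1<C_2$ means $C_1\le C_2$ and $C_1\neq C_2$. *)

theory Defs
  imports Main "HOL-Library.FuncSet"
begin

text \<open>
  A map from the power set of \<open>L\<close> to itself is an element of the extensional function space
  \<open>Pow L \<rightarrow>\<^sub>E Pow L\<close>. Two such maps are equal as HOL functions iff they agree on every
  subset of \<open>L\<close>, so \<open>=\<close> is equality of operators.
\<close>

definition consequence_ops :: "'a set \<Rightarrow> ('a set \<Rightarrow> 'a set) set" where
  "consequence_ops L =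
    {C \<in> Pow L \<rightarrow>\<^sub>E Pow L.
      (\<forall>X. X \<subseteq> L \<longrightarrow> X \<subseteq> C X \<and> C X = C (C X) \<and> C X \<subseteq> L) \<and>
      (\<forall>X Y. X \<subseteq> L \<longrightarrow> Y \<subseteq> L \<longrightarrow> X \<subseteq> Y \<longrightarrow> C X \<subseteq> C Y)}"

definition axiomatic_ops :: "'a set \<Rightarrow> ('a set \<Rightarrow> 'a set) set" where
  "axiomatic_ops L = {C \<in> consequence_ops L. C {} \<noteq> {}}"

definition op_le :: "'a set \<Rightarrow> ('a set \<Rightarrow> 'a set) \<Rightarrow> ('a set \<Rightarrow> 'a set) \<Rightarrow> bool" where
  "op_le L C1 C2 \<longleftrightarrow> (\<forall>X. X \<subseteq> L \<longrightarrow> C1 X \<subseteq> C2 X)"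

definition op_less :: "'a set \<Rightarrow> ('a set \<Rightarrow> 'a set) \<Rightarrow> ('a set \<Rightarrow> 'a set) \<Rightarrow> bool" where
  "op_less L C1 C2 \<longleftrightarrow> op_le L C1 C2 \<and> C1 \<noteq> C2"

definition id_op :: "'a set \<Rightarrow> 'a set \<Rightarrow> 'a set" where
  "id_op L = (\<lambda>A\<in>Pow L. A)"

text \<open>The operator written \<open>C'(X,Y)\<close>, for \<open>X, Y \<subseteq> L\<close>.\<close>

definition C_prime :: "'a set \<Rightarrow> 'a set \<Rightarrow> 'a set \<Rightarrow> 'a set \<Rightarrow> 'a set" where
  "C_prime L X Y = (\<lambda>A\<in>Pow L. if Y \<subseteq> A then A \<union> X else A)"

definition E_op :: "'a set \<Rightarrow> 'a \<Rightarrow> 'a set \<Rightarrow> 'a set" where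
  "E_op L x = C_prime L {x} (L - {x})"

definition E0 :: "'a set \<Rightarrow> ('a set \<Rightarrow> 'a set) set" where
  "E0 L = {E_op L x | x. x \<in> L}"

definition atom_op :: "'a set \<Rightarrow> ('a set \<Rightarrow> 'a set) \<Rightarrow> bool" where
  "atom_op L E \<longleftrightarrow> E \<in> consequence_ops L \<and> op_less L (id_op L) E \<and>
    \<not> (\<exists>C \<in> consequence_ops L. op_less L (id_op L) C \<and> op_less L C E)"

text \<open>
  The family \<open>\<A>\<close> densely covers \<open>\<B>\<close>: every member of the covering family \<open>\<A>\<close> lies
  above some member of \<open>\<B>\<close>.
\<close>

definition densely_covers ::
  "'a set \<Rightarrow> ('a set \<Rightarrow> 'a set) set \<Rightarrow> ('a set \<Rightarrow> 'a set) set \<Rightarrow> bool" where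
  "densely_covers L \<A> \<B> \<longleftrightarrow> (\<forall>C\<in>\<A>. \<exists>E\<in>\<B>. op_le L E C)"

end

theory Submission
  imports Defs
begin

text \<open>
  The operator \<open>E\<^sub>x\<close> moves only the set \<open>L - {x}\<close>, which it sends to \<open>L\<close>. An operator
  strictly above the identity and below \<open>E\<^sub>x\<close> must move that set as well, and there is no room
  to send it anywhere but to \<open>L\<close>. If \<open>x\<close> is an axiom of \<open>C\<close>, then \<open>x \<in> C A\<close> for all \<open>A\<close>
  by monotonicity, so \<open>E\<^sub>x \<le> C\<close>.
\<close>

text \<open>The only subsets of \<open>L\<close> containing \<open>L - {x}\<close> are
  \<open>L - {x}\<close> and \<open>L\<close>, and adding \<open>x\<close> to \<open>L\<close>
  changes nothing.\<close>

lemma E_op_apply: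
  assumes "x \<in> L" "A \<subseteq> L"
  shows "E_op L x A = (if A = L - {x} then L else A)"
  using assms unfolding E_op_def C_prime_def by auto

lemma consequence_opsD:
  assumes "C \<in> consequence_ops L"
  shows consequence_ops_funcset: "C \<in> Pow L \<rightarrow>\<^sub>E Pow L"
    and consequence_ops_increasing: "A \<subseteq> L \<Longrightarrow> A \<subseteq> C A"
    and consequence_ops_closed: "A \<subseteq> L \<Longrightarrow> C A \<subseteq> L"
    and consequence_ops_mono: "A \<subseteq> B \<Longrightarrow> B \<subseteq> L \<Longrightarrow> C A \<subseteq> C B"
proof -
  note C = assms[unfolded consequence_ops_def mem_Collect_eq]
  show "C \<in> Pow L \<rightarrow>\<^sub>E Pow L"
    using C by (rule conjunct1)
  show "A \<subseteq> C A" "C A \<subseteq> L" if "A \<subseteq> L"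
    using C[THEN conjunct2, THEN conjunct1, rule_format, OF that] by blast+
  show "C A \<subseteq> C B" if "A \<subseteq> B" "B \<subseteq> L"
    using C[THEN conjunct2, THEN conjunct2, rule_format, OF order_trans[OF that] that(2,1)] .
qed

text \<open>Both maps are extensional, hence \<open>undefined\<close> outside \<open>Pow L\<close>,
  so agreement on subsets of \<open>L\<close> already gives HOL equality.\<close>

lemma consequence_ops_eqI:
  assumes "C \<in> consequence_ops L" "D \<in> Pow L \<rightarrow>\<^sub>E Pow L"
    and "\<And>A. A \<subseteq> L \<Longrightarrow> C A = D A"
  shows "C = D"
  using consequence_ops_funcset[OF assms(1)] assms(2)
  by (rule PiE_ext) (simp add: assms(3))

lemma E_op_consequence_ops:
  assumes "x \<in> L"
  shows "E_op L x \<in> consequence_ops L"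
  unfolding consequence_ops_def
proof (intro CollectI conjI allI impI)
  show "E_op L x \<in> Pow L \<rightarrow>\<^sub>E Pow L"
    using assms by (auto simp: E_op_def C_prime_def)
  fix X
  assume X: "X \<subseteq> L"
  show "X \<subseteq> E_op L x X" "E_op L x X \<subseteq> L"
    using X assms by (auto simp: E_op_apply)
  \<comment> \<open>Since \<open>x\<close> lies in \<open>L\<close>, no value of
    \<open>E_op L x\<close> is \<open>L - {x}\<close>, the only set that is moved.\<close>
  show "E_op L x X = E_op L x (E_op L x X)"
    using X assms by (cases "X = L - {x}") (simp_all add: E_op_apply)
  fix Y
  assume "Y \<subseteq> L" "X \<subseteq> Y"
  \<comment> \<open>The original condition \<open>L - {x} \<subseteq> A\<close> is inherited by
    supersets of \<open>A\<close>, which makes monotonicity immediate.\<close>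
  then show "E_op L x X \<subseteq> E_op L x Y"
    using X by (auto simp: E_op_def C_prime_def)
qed

lemma id_op_less_E_op:
  assumes "x \<in> L"
  shows "op_less L (id_op L) (E_op L x)"
proof -
  have "id_op L (L - {x}) \<noteq> E_op L x (L - {x})"
    using assms by (auto simp: id_op_def E_op_apply)
  moreover have "op_le L (id_op L) (E_op L x)"
    using assms by (auto simp: op_le_def id_op_def E_op_apply)
  ultimately show ?thesis
    unfolding op_less_def by metis
qed

lemma atom_op_E_op:
  assumes "x \<in> L"
  shows "atom_op L (E_op L x)"
proof -
  have "C = E_op L x"
    if C: "C \<in> consequence_ops L" and "id_op L \<noteq> C" and le: "op_le L C (E_op L x)" for C
  proof -
    \<comment> \<open>Here \<open>E_op L x\<close> acts as the identity, which squeezes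
      \<open>C A\<close> between \<open>A\<close> and \<open>A\<close>.\<close>
    have fixed: "C A = A" if "A \<subseteq> L" "A \<noteq> L - {x}" for A
    proof
      have "C A \<subseteq> E_op L x A"
        using le that unfolding op_le_def by blast
      then show "C A \<subseteq> A"
        using that assms by (simp add: E_op_apply)
      show "A \<subseteq> C A"
        using C that by (simp add: consequence_ops_increasing)
    qed
    \<comment> \<open>Were this last set fixed too, \<open>C\<close> would agree with the identity
      everywhere.\<close>
    have "C (L - {x}) \<noteq> L - {x}"
    proof
      assume "C (L - {x}) = L - {x}"
      with fixed have "C A = id_op L A" if "A \<subseteq> L" for A
        using that by (cases "A = L - {x}") (simp_all add: id_op_def)
      moreover have "id_op L \<in> Pow L \<rightarrow>\<^sub>E Pow L"
        by (simp add: id_op_def)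
      ultimately have "C = id_op L"
        by (intro consequence_ops_eqI[OF C])
      with \<open>id_op L \<noteq> C\<close> show False
        by simp
    qed
    moreover have "L - {x} \<subseteq> C (L - {x})" "C (L - {x}) \<subseteq> L"
      using consequence_ops_increasing[OF C] consequence_ops_closed[OF C] by simp_all
    \<comment> \<open>\<open>L - {x}\<close> and \<open>L\<close> differ by one element, so no set
      lies strictly between them.\<close>
    ultimately have "C (L - {x}) = L"
      by blast
    with fixed have "C A = E_op L x A" if "A \<subseteq> L" for A
      using that assms by (simp add: E_op_apply)
    then show ?thesis
      by (intro consequence_ops_eqI[OF C]
          consequence_ops_funcset[OF E_op_consequence_ops[OF assms]])
  qed
  then show ?thesis
    using E_op_consequence_ops[OF assms] id_op_less_E_op[OF assms]
    unfolding atom_op_def op_less_def by blast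
qed

lemma E_op_le_axiomatic:
  assumes C: "C \<in> consequence_ops L" and x: "x \<in> C {}"
  shows "op_le L (E_op L x) C"
  unfolding op_le_def
proof (intro allI impI)
  fix A
  assume A: "A \<subseteq> L"
  have "x \<in> C A"
    using consequence_ops_mono[OF C empty_subsetI A] x by (rule subsetD)
  then show "E_op L x A \<subseteq> C A"
    using A consequence_ops_increasing[OF C A] by (auto simp: E_op_def C_prime_def)
qed

theorem theorem2p7:
  fixes L :: "'a set"
  assumes "L \<noteq> {}"
  shows "(\<forall>x\<in>L. atom_op L (E_op L x)) \<and>
         densely_covers L (axiomatic_ops L) (E0 L)"
proof
  show "\<forall>x\<in>L. atom_op L (E_op L x)"
    using atom_op_E_op by (rule ballI)
  have "\<exists>E\<in>E0 L. op_le L E C" if C: "C \<in> consequence_ops L" "C {} \<noteq> {}" for C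
  proof -
    from C(2) obtain x where x: "x \<in> C {}"
      by auto
    \<comment> \<open>This puts the axiom \<open>x\<close> in \<open>L\<close>, as membership in
      \<open>E0 L\<close> demands.\<close>
    have "C {} \<subseteq> L"
      using C(1) by (simp add: consequence_ops_closed)
    with x have "E_op L x \<in> E0 L"
      unfolding E0_def by blast
    with E_op_le_axiomatic[OF C(1) x] show ?thesis
      by (rule bexI)
  qed
  then show "densely_covers L (axiomatic_ops L) (E0 L)"
    unfolding densely_covers_def axiomatic_ops_def by simp
qed

end
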